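(* Let $d\geq 2$ be an integer. For every $2$-colored complete digraph $K$ (finite or infinite, with loops), there exists a cover of $K$ by at most $2\sum_{i=1}^d d^i=2d\left(\frac{d^{d}-1}{d-1}\right)$ monochromatic $d$-dominating subgraphs. In the case $d=2$, there exists a cover of $K$ by at most eight monochromatic $2$-dominating subgraphs.
   Context: A digraph is a pair $(V,E)$ with $V$ finite or infinite and $E\subseteq V\times V$ (loops allowed). It is complete if $E=V\times V$. A subgraph of $(V,E)$ is a pair $(V',E')$ with $V'\subseteq V$, $E'\subseteq E$ (and $E'\subseteq V'\times V'$). For $X,Y\subseteq V$, $X$ dominates $Y$ if $(x,y)\in E$ for all $x\in X,y\in Y$. A digraph $G=(V,E)$ is $d$-dominating if every $S\subseteq V$ with $1\le |S|\le d$ dominates some vertex $w\in V$ (possibly $w\in S$, in which case the loop $(w,w)$ must be in $E$). A $2$-coloring of $G$ is a map $c:E\to\{1,2\}$; $G_i=(V,c^{-1}(i))$. A cover of $G$ is a set of subgraphs $\{H_1,\dots,H_t\}$ with $V(G)=\bigcup_i V(H_i)$; it is a cover by monochromatic subgraphs if each $H_i\subseteq G_j$ for some $j\in\{1,2\}$. *)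

theory Defs
  imports Complex_Main "HOL-Library.FuncSet" "Graph_Theory.Digraph_Component"
begin

text \<open>
  A digraph is a \<^typ>\<open>'a pair_pre_digraph\<close>: a vertex set and a set of ordered pairs of
  vertices, with loops allowed and no finiteness assumed. Well-formedness (arcs join vertices)
  is part of \<^const>\<open>subgraph\<close>, and for complete digraphs it follows from the definition.
\<close>

definition complete_with_loops :: "'a pair_pre_digraph \<Rightarrow> bool" where
  "complete_with_loops G \<longleftrightarrow> parcs G = pverts G \<times> pverts G"

definition set_dominates :: "'a pair_pre_digraph \<Rightarrow> 'a set \<Rightarrow> 'a set \<Rightarrow> bool" where
  "set_dominates G X Y \<longleftrightarrow> (\<forall>x\<in>X. \<forall>y\<in>Y. (x, y) \<in> parcs G)"

definition d_dominating :: "nat \<Rightarrow> 'a pair_pre_digraph \<Rightarrow> bool" where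
  "d_dominating d G \<longleftrightarrow>
     (\<forall>S \<subseteq> pverts G. finite S \<and> 1 \<le> card S \<and> card S \<le> d \<longrightarrow>
        (\<exists>w \<in> pverts G. set_dominates G S {w}))"

text \<open>The values of a colouring outside the arc set are irrelevant.\<close>

definition two_coloring :: "'a pair_pre_digraph \<Rightarrow> ('a \<times> 'a \<Rightarrow> nat) \<Rightarrow> bool" where
  "two_coloring G c \<longleftrightarrow> c \<in> parcs G \<rightarrow> {1, 2}"

definition color_class :: "'a pair_pre_digraph \<Rightarrow> ('a \<times> 'a \<Rightarrow> nat) \<Rightarrow> nat \<Rightarrow> 'a pair_pre_digraph" where
  "color_class G c i = \<lparr> pverts = pverts G, parcs = {e \<in> parcs G. c e = i} \<rparr>"

definition monochromatic ::
    "'a pair_pre_digraph \<Rightarrow> ('a \<times> 'a \<Rightarrow> nat) \<Rightarrow> 'a pair_pre_digraph \<Rightarrow> bool" where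
  "monochromatic G c H \<longleftrightarrow>
     (\<exists>j \<in> {1, 2}. subgraph (with_proj H) (with_proj (color_class G c j)))"

definition cover :: "'a pair_pre_digraph \<Rightarrow> 'a pair_pre_digraph set \<Rightarrow> bool" where
  "cover G \<H> \<longleftrightarrow>
     finite \<H> \<and> (\<forall>H \<in> \<H>. subgraph (with_proj H) (with_proj G)) \<and>
     pverts G = (\<Union>H \<in> \<H>. pverts H)"

end

theory Submission
  imports Defs
begin

text \<open>
  Split the vertices by the colour of their loop; by symmetry let all loops be red. Then for every
  vertex \<open>s\<close> the star of all vertices with a red arc to \<open>s\<close> is red and \<open>d\<close>-dominating. If the whole
  set is not \<open>d\<close>-dominating in red, some \<open>d\<close>-set \<open>S\<close> has no common red out-neighbour, so a
  vertex outside the stars of \<open>S\<close> is joined in blue in both directions to some \<open>s \<in> S\<close>.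
  Iterating \<open>d - 1\<close> times leaves sets \<open>A\<close> that are joined in blue in both directions to a
  blue clique \<open>T\<close> of size \<open>d - 1\<close>. Let \<open>D\<close> be the largest subset of \<open>A\<close> in which
  every vertex has a blue out-neighbour. Then \<open>T \<union> D\<close> is \<open>d\<close>-dominating in blue and \<open>A - D\<close> is
  \<open>d\<close>-dominating in red, because any finite subset of it can be ordered with all forward arcs red.

  For \<open>d = 2\<close> let \<open>N a\<close> be the set of vertices joined in blue in both directions to \<open>a\<close>. If some
  \<open>N a\<close> has such a subset \<open>D \<noteq> {}\<close>, then the stars of \<open>a\<close> and of some \<open>x \<in> D\<close>, and \<open>a\<close> together
  with the vertices having blue arcs both to \<open>a\<close> and into \<open>D\<close>, cover everything. Otherwise every
  \<open>N a\<close> is \<open>2\<close>-dominating in red, and the stars of \<open>a\<close> and \<open>b\<close>, \<open>N a\<close> and \<open>N b\<close> suffice for any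
  pair \<open>a\<close>, \<open>b\<close> without a common red out-neighbour.
\<close>

section \<open>Domination and coverings in terms of a relation\<close>

definition rel_dominating :: "nat \<Rightarrow> ('a \<Rightarrow> 'a \<Rightarrow> bool) \<Rightarrow> 'a set \<Rightarrow> bool" where
  "rel_dominating d E W \<longleftrightarrow>
     (\<forall>S \<subseteq> W. finite S \<and> 1 \<le> card S \<and> card S \<le> d \<longrightarrow> (\<exists>w \<in> W. \<forall>s \<in> S. E s w))"

text \<open>\<open>E\<close> is the red relation and its negation the blue one.\<close>

definition mono_dominating :: "nat \<Rightarrow> ('a \<Rightarrow> 'a \<Rightarrow> bool) \<Rightarrow> 'a set \<Rightarrow> bool" where
  "mono_dominating d E W \<longleftrightarrow> rel_dominating d E W \<or> rel_dominating d (\<lambda>x y. \<not> E x y) W"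

text \<open>Members of \<open>F\<close> may leave \<open>A\<close> but not \<open>V\<close>: the
  stars and the sets \<open>T \<union> D\<close> that cover a part \<open>A\<close> reach outside
  it.\<close>

definition coverable :: "nat \<Rightarrow> ('a \<Rightarrow> 'a \<Rightarrow> bool) \<Rightarrow> 'a set \<Rightarrow> 'a set \<Rightarrow> nat \<Rightarrow> bool" where
  "coverable d E V A n \<longleftrightarrow>
     (\<exists>F. finite F \<and> card F \<le> n \<and> A \<subseteq> \<Union>F \<and> (\<forall>W \<in> F. W \<subseteq> V \<and> mono_dominating d E W))"

definition out_closed :: "('a \<Rightarrow> 'a \<Rightarrow> bool) \<Rightarrow> 'a set \<Rightarrow> bool" where
  "out_closed E D \<longleftrightarrow> (\<forall>x \<in> D. \<exists>y \<in> D. E x y)"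

lemma not_rel_dominatingE:
  assumes "\<not> rel_dominating d E A"
  obtains S where "S \<subseteq> A" "finite S" "card S \<le> d" "\<forall>w \<in> A. \<exists>s \<in> S. \<not> E s w"
proof -
  have "\<exists>S \<subseteq> A. (finite S \<and> 1 \<le> card S \<and> card S \<le> d) \<and> \<not> (\<exists>w \<in> A. \<forall>s \<in> S. E s w)"
    using assms unfolding rel_dominating_def by (simp only: not_all not_imp simp_thms)
  then show ?thesis
    by (elim exE conjE) (rule that, assumption+, simp)
qed

lemma mono_dominating_complement:
  "mono_dominating d (\<lambda>x y. \<not> E x y) W \<longleftrightarrow> mono_dominating d E W"
  by (auto simp: mono_dominating_def)

lemma coverable_complement:
  "coverable d (\<lambda>x y. \<not> E x y) V A n \<longleftrightarrow> coverable d E V A n"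
  by (simp add: coverable_def mono_dominating_complement)

lemma coverable_mono:
  assumes "coverable d E V A n" "B \<subseteq> A" "V \<subseteq> V'" "n \<le> m"
  shows "coverable d E V' B m"
  using assms unfolding coverable_def by (meson order_trans)

lemma coverable_single:
  assumes "W \<subseteq> V" "mono_dominating d E W"
  shows "coverable d E V W 1"
  unfolding coverable_def using assms by (intro exI[of _ "{W}"]) auto

lemma coverable_empty: "coverable d E V {} n"
  unfolding coverable_def by (intro exI[of _ "{}"]) auto

lemma coverable_Un:
  assumes "coverable d E V A n" "coverable d E V B m"
  shows "coverable d E V (A \<union> B) (n + m)"
proof -
  obtain F where F: "finite F" "card F \<le> n" "A \<subseteq> \<Union>F" "\<forall>W \<in> F. W \<subseteq> V \<and> mono_dominating d E W"
    using assms(1) unfolding coverable_def by blast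
  obtain F' where F': "finite F'" "card F' \<le> m" "B \<subseteq> \<Union>F'"
    "\<forall>W \<in> F'. W \<subseteq> V \<and> mono_dominating d E W"
    using assms(2) unfolding coverable_def by blast
  have "card (F \<union> F') \<le> n + m"
    using card_Un_le[of F F'] F(2) F'(2) by linarith
  moreover have "A \<union> B \<subseteq> \<Union>(F \<union> F')"
    using F(3) F'(3) by blast
  moreover have "\<forall>W \<in> F \<union> F'. W \<subseteq> V \<and> mono_dominating d E W"
    using F(4) F'(4) by blast
  ultimately show ?thesis
    unfolding coverable_def using F(1) F'(1) by blast
qed

lemma coverable_UN:
  assumes "finite S" "\<And>s. s \<in> S \<Longrightarrow> coverable d E V (A s) n"
  shows "coverable d E V (\<Union>s \<in> S. A s) (card S * n)"
  using assms
proof (induction S rule: finite_induct)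
  case empty
  show ?case by (simp add: coverable_empty)
next
  case (insert s S)
  have "coverable d E V (A s \<union> (\<Union>s \<in> S. A s)) (n + card S * n)"
    using insert by (intro coverable_Un) auto
  then show ?case using insert(1,2) by simp
qed

section \<open>Stars, out-closed sets and cliques\<close>

text \<open>The loop puts \<open>s\<close> into its own star, where it is a common out-neighbour of
  every subset.\<close>

lemma coverable_star:
  assumes "E s s" "s \<in> V"
  shows "coverable d E V {w \<in> V. E w s} 1"
proof (rule coverable_single)
  show "mono_dominating d E {w \<in> V. E w s}"
    unfolding mono_dominating_def rel_dominating_def using assms by blast
qed auto

text \<open>A nonempty finite \<open>S\<close> is not out-closed in blue, so some \<open>x\<close>
  in it has red arcs to all of \<open>S\<close>. A witness for \<open>S - {x}\<close> then also
  serves for \<open>S\<close>; if only \<open>x\<close> is left, its red loop does.\<close>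

lemma rel_dominating_if_no_out_closed:
  assumes "\<And>D. D \<subseteq> A \<Longrightarrow> out_closed (\<lambda>x y. \<not> E x y) D \<Longrightarrow> D = {}"
  shows "rel_dominating d E A"
proof -
  have "\<exists>w \<in> S. \<forall>s \<in> S. E s w" if "finite S" "S \<noteq> {}" "S \<subseteq> A" for S
    using that
  proof (induction S rule: finite_psubset_induct)
    case (psubset S)
    obtain x where x: "x \<in> S" "\<forall>y \<in> S. E x y"
      using assms[of S] psubset.prems unfolding out_closed_def by blast
    show ?case
    proof (cases "S - {x} = {}")
      case True
      then show ?thesis using x by blast
    next
      case False
      then obtain w where "w \<in> S - {x}" "\<forall>s \<in> S - {x}. E s w"
        using psubset.IH[of "S - {x}"] psubset.prems x(1) by blast
      then show ?thesis using x by blast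
    qed
  qed
  then show ?thesis
    unfolding rel_dominating_def by (metis card.empty not_one_le_zero subsetD)
qed

text \<open>If \<open>S\<close> misses some \<open>t\<close> in \<open>T\<close>, then
  \<open>t\<close> works, as no loop at \<open>t\<close> is asked for. Otherwise at most one vertex
  of \<open>S\<close> is outside \<open>T\<close>, and its out-neighbour in \<open>D\<close>
  works.\<close>

lemma rel_dominating_clique_Un:
  assumes "finite T" "d = Suc (card T)" "D \<noteq> {}" "out_closed E D"
    and clique: "\<And>t t'. t \<in> T \<Longrightarrow> t' \<in> T \<Longrightarrow> t \<noteq> t' \<Longrightarrow> E t t'"
    and joined: "\<And>t x. t \<in> T \<Longrightarrow> x \<in> D \<Longrightarrow> E t x \<and> E x t"
  shows "rel_dominating d E (T \<union> D)"
  unfolding rel_dominating_def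
proof (intro allI impI)
  fix S assume S: "S \<subseteq> T \<union> D" "finite S \<and> 1 \<le> card S \<and> card S \<le> d"
  show "\<exists>w \<in> T \<union> D. \<forall>s \<in> S. E s w"
  proof (cases "T \<subseteq> S")
    case False
    then obtain t where t: "t \<in> T" "t \<notin> S" by blast
    then have "\<forall>s \<in> S. E s t" using S(1) clique joined by blast
    then show ?thesis using t by blast
  next
    case True
    then have "card (S - T) \<le> 1"
      using S(2) assms(2) card_Diff_subset[OF assms(1) True] by linarith
    then obtain x where x: "S - T \<subseteq> {x}"
      using S(2) by (metis One_nat_def card_le_Suc0_iff_eq finite_Diff subsetI singletonI)
    \<comment> \<open>For \<open>S = T\<close> the vertex \<open>x\<close> is arbitrary, hence the
      guard.\<close>
    obtain y where y: "y \<in> D" "x \<in> D \<longrightarrow> E x y"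
      using assms(3,4) unfolding out_closed_def by blast
    have "\<forall>s \<in> S. E s y" using S(1) x y joined by blast
    then show ?thesis using y(1) by blast
  qed
qed

lemma coverable_joined_to_clique:
  assumes "T \<subseteq> V" "A \<subseteq> V" "finite T" "d = Suc (card T)"
    and clique: "\<And>t t'. t \<in> T \<Longrightarrow> t' \<in> T \<Longrightarrow> t \<noteq> t' \<Longrightarrow> \<not> E t t'"
    and joined: "\<And>t x. t \<in> T \<Longrightarrow> x \<in> A \<Longrightarrow> \<not> E t x \<and> \<not> E x t"
  shows "coverable d E V A 2"
proof -
  define D where "D = \<Union>{D. D \<subseteq> A \<and> out_closed (\<lambda>x y. \<not> E x y) D}"
  have DA: "D \<subseteq> A" unfolding D_def by blast
  have closed: "out_closed (\<lambda>x y. \<not> E x y) D"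
    unfolding D_def out_closed_def by blast
  have "rel_dominating d E (A - D)"
  proof (rule rel_dominating_if_no_out_closed)
    fix D' assume "D' \<subseteq> A - D" "out_closed (\<lambda>x y. \<not> E x y) D'"
    \<comment> \<open>By maximality \<open>D'\<close> also lies in \<open>D\<close>.\<close>
    then show "D' = {}" unfolding D_def by blast
  qed
  then have red: "coverable d E V (A - D) 1"
    using assms(2) by (intro coverable_single) (auto simp: mono_dominating_def)
  have blue: "coverable d E V D 1"
  proof (cases "D = {}")
    case True
    then show ?thesis by (simp add: coverable_empty)
  next
    case False
    have "rel_dominating d (\<lambda>x y. \<not> E x y) (T \<union> D)"
      by (rule rel_dominating_clique_Un[OF assms(3,4) False closed])
        (use clique joined DA in blast)+
    then have "coverable d E V (T \<union> D) 1"
      using assms(1,2) DA by (intro coverable_single) (auto simp: mono_dominating_def)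
    then show ?thesis by (rule coverable_mono) auto
  qed
  have "coverable d E V (D \<union> (A - D)) (1 + 1)"
    by (rule coverable_Un[OF blue red])
  then show ?thesis by (rule coverable_mono) auto
qed

section \<open>General \<open>d\<close>, all loops red\<close>

text \<open>Induction on \<open>j\<close>, the number of vertices that \<open>T\<close> lacks to
  reach size \<open>d - 1\<close>. A step leaves at most \<open>d\<close> stars and \<open>d\<close>
  smaller problems, so the bound satisfies f(j + 1) = d (1 + f(j)), with f(0) = d \<ge> 2.\<close>

lemma coverable_reflexive_step:
  assumes "d \<ge> 2" "\<And>v. v \<in> V \<Longrightarrow> E v v"
    and "T \<subseteq> V" "A \<subseteq> V" "finite T" "d = Suc j + card T"
    and "\<And>t t'. t \<in> T \<Longrightarrow> t' \<in> T \<Longrightarrow> t \<noteq> t' \<Longrightarrow> \<not> E t t'"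
    and "\<And>t x. t \<in> T \<Longrightarrow> x \<in> A \<Longrightarrow> \<not> E t x \<and> \<not> E x t"
  shows "coverable d E V A (\<Sum>i = 1..Suc j. d ^ i)"
  using assms(3-)
proof (induction j arbitrary: T A)
  case 0
  then have "coverable d E V A 2"
    by (intro coverable_joined_to_clique[of T]) auto
  then show ?case by (rule coverable_mono) (use assms(1) in auto)
next
  case (Suc j)
  let ?n = "\<Sum>i = 1..Suc j. d ^ i"
  have sum_Suc: "(\<Sum>i = 1..Suc (Suc j). d ^ i) = d * (1 + ?n)"
    by (simp add: sum.atLeast_Suc_atMost sum.shift_bounds_cl_Suc_ivl sum_distrib_left
        algebra_simps del: sum.cl_ivl_Suc)
  show ?case
  proof (cases "rel_dominating d E A")
    case True
    then have "coverable d E V A 1"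
      using Suc.prems(2) by (intro coverable_single) (auto simp: mono_dominating_def)
    then show ?thesis
      unfolding sum_Suc by (rule coverable_mono) (use assms(1) in auto)
  next
    case False
    then obtain S where S: "S \<subseteq> A" "finite S" "card S \<le> d"
      and undominated: "\<forall>w \<in> A. \<exists>s \<in> S. \<not> E s w"
      by (rule not_rel_dominatingE)
    \<comment> \<open>A vertex of \<open>A\<close> without a red arc from \<open>s\<close> is in the
      star of \<open>s\<close> or in \<open>B s\<close>.\<close>
    define B where "B s = {w \<in> A. \<not> E w s \<and> \<not> E s w}" for s
    have "coverable d E V ({w \<in> V. E w s} \<union> B s) (1 + ?n)" if s: "s \<in> S" for s
    proof (rule coverable_Un)
      have sV: "s \<in> V" "s \<in> A" using s S(1) Suc.prems(2) by blast+
      then show "coverable d E V {w \<in> V. E w s} 1"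
        using assms(2) by (intro coverable_star) auto
      \<comment> \<open>Arcs from \<open>T\<close> to \<open>A\<close> are blue, but
        \<open>s\<close> in \<open>A\<close> has a red loop. So \<open>insert s T\<close> really
        grows.\<close>
      have "s \<notin> T" using Suc.prems(6) sV assms(2) by blast
      then show "coverable d E V (B s) ?n"
        using sV Suc.prems by (intro Suc.IH[of "insert s T"]) (auto simp: B_def)
    qed
    then have "coverable d E V (\<Union>s \<in> S. {w \<in> V. E w s} \<union> B s) (card S * (1 + ?n))"
      by (rule coverable_UN[OF S(2)])
    moreover have "A \<subseteq> (\<Union>s \<in> S. {w \<in> V. E w s} \<union> B s)"
      using Suc.prems(2) undominated unfolding B_def by blast
    ultimately show ?thesis
      unfolding sum_Suc by (rule coverable_mono) (simp, rule mult_le_mono1[OF S(3)])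
  qed
qed

lemma coverable_reflexive:
  assumes "d \<ge> 2" "\<And>v. v \<in> V \<Longrightarrow> E v v"
  shows "coverable d E V V (\<Sum>i = 1..d. d ^ i)"
proof -
  have "coverable d E V V (\<Sum>i = 1..Suc (d - 1). d ^ i)"
    by (rule coverable_reflexive_step[of d V E "{}"]) (use assms in auto)
  moreover have "Suc (d - 1) = d" using assms(1) by simp
  ultimately show ?thesis by (simp only:)
qed

section \<open>The case \<open>d = 2\<close>, all loops red\<close>

lemma coverable_two_reflexive:
  assumes refl: "\<And>v. v \<in> V \<Longrightarrow> E v v"
  shows "coverable 2 E V V 4"
proof -
  define N where "N a = {w \<in> V. \<not> E w a \<and> \<not> E a w}" for a
  define R where "R a = {w \<in> V. E w a}" for a
  have star: "coverable 2 E V (R a) 1" if "a \<in> V" for a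
    unfolding R_def using refl that by (intro coverable_star) auto
  show ?thesis
  proof (cases "\<exists>a \<in> V. \<exists>D \<subseteq> N a. D \<noteq> {} \<and> out_closed (\<lambda>x y. \<not> E x y) D")
    case True
    then obtain a D x where aD: "a \<in> V" "D \<subseteq> N a" "x \<in> D" "out_closed (\<lambda>x y. \<not> E x y) D"
      by blast
    \<comment> \<open>Vertices outside \<open>R a\<close> and \<open>R x\<close> have blue arcs to
      \<open>a\<close> and \<open>x\<close>, so \<open>W\<close> contains them. Allowing any
      \<open>y\<close> in \<open>D\<close> makes \<open>W\<close> contain \<open>D\<close> as
      well.\<close>
    define W where "W = {w \<in> V. \<not> E w a \<and> (\<exists>y \<in> D. \<not> E w y)}"
    have DW: "D \<subseteq> W" using aD unfolding W_def N_def out_closed_def by blast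
    have "rel_dominating 2 (\<lambda>x y. \<not> E x y) (insert a W)"
      unfolding rel_dominating_def
    proof (intro allI impI)
      fix S assume S: "S \<subseteq> insert a W" "finite S \<and> 1 \<le> card S \<and> card S \<le> 2"
      show "\<exists>w \<in> insert a W. \<forall>s \<in> S. \<not> E s w"
      \<comment> \<open>If \<open>a\<close> is not in \<open>S\<close>, it serves itself. Otherwise
        a blue out-neighbour in \<open>D\<close> of the one other vertex does, since
        \<open>a\<close> has blue arcs to all of \<open>D\<close>.\<close>
      proof (cases "a \<in> S")
        case False
        then have "\<forall>s \<in> S. \<not> E s a" using S(1) unfolding W_def by blast
        then show ?thesis by blast
      next
        case True
        then have "card (S - {a}) \<le> Suc 0" using S(2) by auto
        then obtain z where z: "S - {a} \<subseteq> {z}"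
          using S(2) by (metis card_le_Suc0_iff_eq finite_Diff subsetI singletonI)
        obtain y where y: "y \<in> D" "z \<in> W \<longrightarrow> \<not> E z y"
          using aD(3) unfolding W_def by blast
        have "\<not> E a y" using aD(2) y(1) unfolding N_def by blast
        then have "\<forall>s \<in> S. \<not> E s y" using S(1) z y by blast
        then show ?thesis using y(1) DW by blast
      qed
    qed
    then have "coverable 2 E V (insert a W) 1"
      using aD(1) by (intro coverable_single) (auto simp: W_def mono_dominating_def)
    moreover have "x \<in> V" using aD(2,3) unfolding N_def by blast
    ultimately have "coverable 2 E V (R a \<union> (R x \<union> insert a W)) (1 + (1 + 1))"
      by (intro coverable_Un star aD(1))
    moreover have "V \<subseteq> R a \<union> (R x \<union> insert a W)"
      using aD(3) unfolding R_def W_def by blast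
    ultimately show ?thesis by (rule coverable_mono) auto
  next
    case no_closed: False
    have N: "coverable 2 E V (N a) 1" if "a \<in> V" for a
    proof (rule coverable_single)
      have "rel_dominating 2 E (N a)"
        using no_closed that by (intro rel_dominating_if_no_out_closed) blast
      then show "mono_dominating 2 E (N a)" by (simp add: mono_dominating_def)
    qed (auto simp: N_def)
    show ?thesis
    proof (cases "rel_dominating 2 E V")
      case True
      then have "coverable 2 E V V 1"
        by (intro coverable_single) (auto simp: mono_dominating_def)
      then show ?thesis by (rule coverable_mono) auto
    next
      case False
      then obtain S where S: "S \<subseteq> V" "finite S" "card S \<le> 2"
        and undominated: "\<forall>w \<in> V. \<exists>s \<in> S. \<not> E s w"
        by (rule not_rel_dominatingE)
      \<comment> \<open>Two sets for each of at most two vertices make four.\<close>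
      have "coverable 2 E V (\<Union>s \<in> S. R s \<union> N s) (card S * (1 + 1))"
        using S(1) by (intro coverable_UN S(2) coverable_Un star N) auto
      moreover have "V \<subseteq> (\<Union>s \<in> S. R s \<union> N s)"
        using undominated unfolding R_def N_def by blast
      ultimately show ?thesis
        by (rule coverable_mono) (use S(3) in auto)
    qed
  qed
qed

section \<open>Both loop colours, and the return to digraphs\<close>

text \<open>The hypothesis ranges over all relations, so it also applies to the blue relation on the
  vertices with blue loops.\<close>

lemma coverable_split_by_loops:
  assumes "\<And>(E :: 'a \<Rightarrow> 'a \<Rightarrow> bool) V. (\<And>v. v \<in> V \<Longrightarrow> E v v) \<Longrightarrow> coverable d E V V n"
  shows "coverable d E V (V :: 'a set) (2 * n)"
proof -
  have "coverable d E {v \<in> V. E v v} {v \<in> V. E v v} n"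
    by (rule assms) auto
  then have red: "coverable d E V {v \<in> V. E v v} n"
    by (rule coverable_mono) auto
  have "coverable d (\<lambda>x y. \<not> E x y) {v \<in> V. \<not> E v v} {v \<in> V. \<not> E v v} n"
    by (rule assms) auto
  then have blue: "coverable d E V {v \<in> V. \<not> E v v} n"
    unfolding coverable_complement by (rule coverable_mono) auto
  show ?thesis
    by (rule coverable_mono[OF coverable_Un[OF red blue]]) auto
qed

lemma mono_dominating_imp_subgraph:
  assumes K: "complete_with_loops K" "two_coloring K c"
    and W: "W \<subseteq> pverts K" "mono_dominating d (\<lambda>x y. c (x, y) = 1) W"
  shows "\<exists>H. pverts H = W \<and> subgraph (with_proj H) (with_proj K) \<and>
    monochromatic K c H \<and> d_dominating d H"
proof -
  have arcs: "(x, y) \<in> parcs K" "c (x, y) = 1 \<or> c (x, y) = 2"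
    if "x \<in> pverts K" "y \<in> pverts K" for x y
    using K that unfolding complete_with_loops_def two_coloring_def by auto
  have "\<exists>j \<in> {1, 2}. rel_dominating d (\<lambda>x y. c (x, y) = j) W"
  proof (cases "rel_dominating d (\<lambda>x y. c (x, y) = 1) W")
    case False
    then have "rel_dominating d (\<lambda>x y. c (x, y) \<noteq> 1) W"
      using W(2) unfolding mono_dominating_def by blast
    \<comment> \<open>All pairs in \<open>W\<close> are arcs of \<open>K\<close>, so a colour other
      than 1 is 2.\<close>
    then have "rel_dominating d (\<lambda>x y. c (x, y) = 2) W"
      unfolding rel_dominating_def using arcs(2) W(1) by (meson subsetD)
    then show ?thesis by blast
  qed blast
  then obtain j where j: "j \<in> {1, 2}" "rel_dominating d (\<lambda>x y. c (x, y) = j) W"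
    by blast
  define H where "H = \<lparr>pverts = W, parcs = {e \<in> W \<times> W. c e = j}\<rparr>"
  have sub: "subgraph (with_proj H) (with_proj (color_class K c j))"
    "subgraph (with_proj H) (with_proj K)"
    using W(1) K(1) unfolding subgraph_def compatible_def wf_digraph_def
    by (auto simp: H_def color_class_def complete_with_loops_def)
  have "d_dominating d H"
    unfolding d_dominating_def set_dominates_def
  proof (intro allI impI)
    fix S assume S: "S \<subseteq> pverts H" "finite S \<and> 1 \<le> card S \<and> card S \<le> d"
    then obtain w where "w \<in> W" "\<forall>s \<in> S. c (s, w) = j"
      using j(2) unfolding rel_dominating_def H_def by auto
    then show "\<exists>w \<in> pverts H. \<forall>x \<in> S. \<forall>y \<in> {w}. (x, y) \<in> parcs H"
      using S(1) by (auto simp: H_def)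
  qed
  then show ?thesis
    using sub j(1) by (intro exI[of _ H]) (auto simp: H_def monochromatic_def)
qed

lemma coverable_imp_cover:
  assumes K: "complete_with_loops K" "two_coloring K c"
    and "coverable d (\<lambda>x y. c (x, y) = 1) (pverts K) (pverts K) n"
  shows "\<exists>\<H>. cover K \<H> \<and> card \<H> \<le> n \<and> (\<forall>H \<in> \<H>. monochromatic K c H \<and> d_dominating d H)"
proof -
  obtain F where F: "finite F" "card F \<le> n" "pverts K \<subseteq> \<Union>F"
    "\<forall>W \<in> F. W \<subseteq> pverts K \<and> mono_dominating d (\<lambda>x y. c (x, y) = 1) W"
    using assms(3) unfolding coverable_def by blast
  have "\<forall>W \<in> F. \<exists>H. pverts H = W \<and> subgraph (with_proj H) (with_proj K) \<and>
      monochromatic K c H \<and> d_dominating d H"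
    using F(4) mono_dominating_imp_subgraph[OF K] by blast
  then obtain h where h: "\<forall>W \<in> F. pverts (h W) = W \<and> subgraph (with_proj (h W)) (with_proj K) \<and>
      monochromatic K c (h W) \<and> d_dominating d (h W)"
    by metis
  have "pverts K = (\<Union>H \<in> h ` F. pverts H)"
    using F(3,4) h by fastforce
  then have "cover K (h ` F)"
    unfolding cover_def using F(1) h by blast
  moreover have "card (h ` F) \<le> n"
    using card_image_le[OF F(1), of h] F(2) by linarith
  ultimately show ?thesis using h by blast
qed

lemma geometric_sum_from_one:
  assumes "d \<ge> 2"
  shows "real (\<Sum>i = 1..d. d ^ i) = real d * ((real d ^ d - 1) / (real d - 1))"
proof -
  have "(\<Sum>i = 1..d. real d ^ i) = real d * (\<Sum>i<d. real d ^ i)"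
    by (simp add: sum_distrib_left sum.atLeast1_atMost_eq)
  then show ?thesis
    using assms geometric_sum[of "real d" d] by simp
qed

theorem theorem1p2:
  fixes d :: nat and K :: "'a pair_pre_digraph" and c :: "'a \<times> 'a \<Rightarrow> nat"
  assumes "d \<ge> 2"
    and "complete_with_loops K"
    and "two_coloring K c"
  shows "(\<exists>\<H>. cover K \<H> \<and> card \<H> \<le> 2 * (\<Sum>i = 1..d. d ^ i) \<and>
              (\<forall>H \<in> \<H>. monochromatic K c H \<and> d_dominating d H)) \<and>
         real (2 * (\<Sum>i = 1..d. d ^ i)) = 2 * real d * ((real d ^ d - 1) / (real d - 1)) \<and>
         (d = 2 \<longrightarrow>
            (\<exists>\<H>. cover K \<H> \<and> card \<H> \<le> 8 \<and>
              (\<forall>H \<in> \<H>. monochromatic K c H \<and> d_dominating 2 H)))"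
proof (intro conjI impI)
  have "coverable d (\<lambda>x y. c (x, y) = 1) (pverts K) (pverts K) (2 * (\<Sum>i = 1..d. d ^ i))"
    by (intro coverable_split_by_loops coverable_reflexive assms(1))
  then show "\<exists>\<H>. cover K \<H> \<and> card \<H> \<le> 2 * (\<Sum>i = 1..d. d ^ i) \<and>
              (\<forall>H \<in> \<H>. monochromatic K c H \<and> d_dominating d H)"
    by (rule coverable_imp_cover[OF assms(2,3)])
  show "real (2 * (\<Sum>i = 1..d. d ^ i)) = 2 * real d * ((real d ^ d - 1) / (real d - 1))"
    using geometric_sum_from_one[OF assms(1)] by simp
  have "coverable 2 (\<lambda>x y. c (x, y) = 1) (pverts K) (pverts K) (2 * 4)"
    by (intro coverable_split_by_loops coverable_two_reflexive)
  then have "coverable 2 (\<lambda>x y. c (x, y) = 1) (pverts K) (pverts K) 8"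
    by simp
  then show "\<exists>\<H>. cover K \<H> \<and> card \<H> \<le> 8 \<and>
              (\<forall>H \<in> \<H>. monochromatic K c H \<and> d_dominating 2 H)"
    by (rule coverable_imp_cover[OF assms(2,3)])
qed

end
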